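(* Let $\mathcal{U}$ be a non-principal ultrafilter on $\mathbb{N}$ and let $$Y=\{(x_n)\in\ell^\infty\ :\ \lim_{\mathcal{U}}x_n=0\}.$$ Then the quotient space $Y/c_0$ is convex-transitive.
   Context: All Banach spaces are real; $\ell^\infty$ is the space of bounded real sequences with the supremum norm, $c_0$ its closed subspace of sequences converging to $0$ (which is contained in $Y$), and $Y/c_0$ carries the quotient norm. An ultrafilter is non-principal if it contains no singleton; $\lim_{\mathcal{U}}$ is the limit along $\mathcal{U}$. For a Banach space $E$, let $\mathbf{B}_E$ be its closed unit ball, $\mathbf{S}_E$ its unit sphere, and $\mathcal{G}_E$ the group of isometric automorphisms (surjective linear isometries) $T\colon E\to E$; for $x\in E$ write $\mathcal{G}_E(x)=\{T(x): T\in\mathcal{G}_E\}$. The space $E$ is called convex-transitive if $\overline{\mathrm{conv}}(\mathcal{G}_E(x))=\mathbf{B}_E$ (norm-closed convex hull) for every $x\in\mathbf{S}_E$. *)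

theory Defs
  imports "HOL-Analysis.Analysis"
begin

subsection \<open>Convex-transitivity\<close>

text \<open>
  Here a Banach space \<open>E\<close> is a closed linear subspace of an ambient Banach type, with the inherited
  operations and norm. Maps \<open>T : E \<rightarrow> E\<close> are functions on the ambient type of which only the
  restriction to \<open>E\<close> matters. As \<open>E\<close> is closed and convex, the closure of a convex hull of a
  subset of \<open>E\<close> is the same in \<open>E\<close> as in the ambient type.
\<close>

definition isometric_automorphisms :: "'a::banach set \<Rightarrow> ('a \<Rightarrow> 'a) set" where
  "isometric_automorphisms E =
    {T. T ` E = E
      \<and> (\<forall>x\<in>E. \<forall>y\<in>E. T (x + y) = T x + T y)
      \<and> (\<forall>c. \<forall>x\<in>E. T (c *\<^sub>R x) = c *\<^sub>R T x)
      \<and> (\<forall>x\<in>E. norm (T x) = norm x)}"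

definition isometric_orbit :: "'a::banach set \<Rightarrow> 'a \<Rightarrow> 'a set" where
  "isometric_orbit E x = {T x |T. T \<in> isometric_automorphisms E}"

definition convex_transitive :: "'a::banach set \<Rightarrow> bool" where
  "convex_transitive E \<longleftrightarrow>
    (\<forall>x\<in>E. norm x = 1 \<longrightarrow> closure (convex hull (isometric_orbit E x)) = {y\<in>E. norm y \<le> 1})"


subsection \<open>Ultrafilters\<close>

definition ultrafilter :: "'a filter \<Rightarrow> bool" where
  "ultrafilter F \<longleftrightarrow> F \<noteq> bot \<and> (\<forall>P. eventually P F \<or> eventually (\<lambda>x. \<not> P x) F)"

definition nonprincipal :: "'a filter \<Rightarrow> bool" where
  "nonprincipal F \<longleftrightarrow> (\<forall>a. \<not> eventually (\<lambda>x. x \<in> {a}) F)"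

lemma nonprincipal_ultrafilter_le_sequentially:
  fixes U :: "nat filter"
  assumes "ultrafilter U" "nonprincipal U"
  shows "U \<le> sequentially"
proof -
  have "eventually (\<lambda>n. n \<noteq> a) U" for a
    using assms unfolding ultrafilter_def nonprincipal_def by auto
  then have "eventually (\<lambda>n. \<forall>a\<in>{..<N}. n \<noteq> a) U" for N :: nat
    by (intro eventually_ball_finite) auto
  then have "eventually (\<lambda>n. N \<le> n) U" for N
    by (rule eventually_mono) (auto simp: not_less[symmetric])
  then show ?thesis
    unfolding le_filter_def eventually_sequentially by (blast intro: eventually_mono)
qed


subsection \<open>The sequence spaces\<close>

text \<open>The topology of \<^typ>\<open>nat\<close> is discrete, so this is the space of all bounded real sequences,
  with the supremum norm.\<close>

type_synonym linf = "nat \<Rightarrow>\<^sub>C real"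

definition null_along :: "nat filter \<Rightarrow> linf set" where
  "null_along F = {x. ((\<lambda>n. apply_bcontfun x n) \<longlongrightarrow> 0) F}"

definition c0 :: "linf set" where
  "c0 = null_along sequentially"

lemma mem_linf_iff: "f \<in> bcontfun \<longleftrightarrow> bounded (range f)" for f :: "nat \<Rightarrow> real"
  by (simp add: bcontfun_def)

lemma norm_linf: "norm x = (SUP n. \<bar>apply_bcontfun x n\<bar>)" for x :: linf
  unfolding norm_bcontfun_def dist_bcontfun.rep_eq by (simp add: dist_real_def)

text \<open>The library has completeness only over a metric domain, which \<^typ>\<open>nat\<close> is not an instance of.\<close>

instance bcontfun :: (topological_space, complete_space) complete_space
proof
  fix f :: "nat \<Rightarrow> ('a, 'b) bcontfun"
  assume "Cauchy f"
  then obtain g where "uniform_limit UNIV f g sequentially"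
    using uniformly_convergent_eq_cauchy[of "\<lambda>_. True" f]
    unfolding Cauchy_def uniform_limit_sequentially_iff
    by (metis dist_fun_lt_imp_dist_val_lt)
  from uniform_limit_bcontfunE[OF this sequentially_bot]
  obtain l where "f \<longlonglongrightarrow> l" by metis
  then show "convergent f" by (rule convergentI)
qed

instance bcontfun :: (topological_space, banach) banach ..

lemma subspace_null_along: "subspace (null_along F)"
  by (auto simp: subspace_def null_along_def intro: tendsto_add_zero tendsto_mult_right_zero)

lemma closed_null_along: "closed (null_along F)"
  unfolding closed_sequential_limits
proof (intro allI impI, elim conjE)
  fix X and l :: linf
  assume X: "\<forall>n. X n \<in> null_along F" and "X \<longlonglongrightarrow> l"
  show "l \<in> null_along F"
    unfolding null_along_def mem_Collect_eq
  proof (rule tendstoI)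
    fix e :: real assume "0 < e"
    then have "\<forall>\<^sub>F n in sequentially. dist (X n) l < e / 2"
      using \<open>X \<longlonglongrightarrow> l\<close> by (intro tendstoD) auto
    then obtain n where n: "dist (X n) l < e / 2"
      by (auto simp: eventually_sequentially)
    have "\<forall>\<^sub>F k in F. dist (X n k) 0 < e / 2"
      using X \<open>0 < e\<close> by (intro tendstoD) (auto simp: null_along_def)
    then show "\<forall>\<^sub>F k in F. dist (l k) 0 < e"
    proof eventually_elim
      case (elim k)
      have "dist (l k) 0 \<le> dist (X n k) (l k) + dist (X n k) 0"
        by (rule dist_triangle3)
      also have "dist (X n k) (l k) < e / 2"
        using n by (rule dist_fun_lt_imp_dist_val_lt)
      finally show ?case using elim by linarith
    qed
  qed
qed

lemma null_along_mono: "F \<le> G \<Longrightarrow> null_along G \<subseteq> null_along F"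
  by (auto simp: null_along_def intro: tendsto_mono)

lemma subspace_c0: "subspace c0" and closed_c0: "closed c0"
  by (simp_all add: c0_def subspace_null_along closed_null_along)


subsection \<open>Quotients by \<open>c0\<close>\<close>

text \<open>
  A type cannot depend on the ultrafilter, so the quotient of \<open>Y = null_along U\<close> by \<open>c0\<close> is formed
  inside the quotient of the whole of \<open>linf\<close>, as the set of cosets of the elements of \<open>Y\<close>; a coset
  \<open>y + c0\<close> and its norm are the same in both quotients.
\<close>

quotient_type linf_mod_c0 = linf / "\<lambda>x y. x - y \<in> c0"
  morphisms rep_linf_mod_c0 coset
proof (rule equivpI)
  show "reflp (\<lambda>x y. x - y \<in> c0)"
    by (simp add: reflp_def subspace_0 subspace_c0)
  show "symp (\<lambda>x y. x - y \<in> c0)"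
    unfolding symp_def using subspace_neg[OF subspace_c0] by fastforce
  show "transp (\<lambda>x y. x - y \<in> c0)"
    unfolding transp_def using subspace_add[OF subspace_c0] by fastforce
qed

lemma coset_cases:
  obtains x where "q = coset x"
  by (induction q rule: linf_mod_c0.abs_induct) blast

lemma INF_norm_coset_le:
  fixes x y :: linf
  assumes "x - y \<in> c0"
  shows "(INF z\<in>c0. norm (x + z)) \<le> (INF z\<in>c0. norm (y + z))"
proof (rule cINF_greatest)
  show "c0 \<noteq> {}" using subspace_0 subspace_c0 by blast
  fix z assume "z \<in> c0"
  then have "z - (x - y) \<in> c0" using assms by (simp add: subspace_c0 subspace_diff)
  then have "(INF z\<in>c0. norm (x + z)) \<le> norm (x + (z - (x - y)))"
    by (intro cINF_lower bdd_belowI2[where m = 0]) auto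
  then show "(INF z\<in>c0. norm (x + z)) \<le> norm (y + z)"
    by (simp add: algebra_simps)
qed

instantiation linf_mod_c0 :: real_vector
begin

lift_definition zero_linf_mod_c0 :: linf_mod_c0 is 0 .

lift_definition plus_linf_mod_c0 :: "linf_mod_c0 \<Rightarrow> linf_mod_c0 \<Rightarrow> linf_mod_c0" is "(+)"
  using subspace_add[OF subspace_c0] by (fastforce simp: algebra_simps)

lift_definition minus_linf_mod_c0 :: "linf_mod_c0 \<Rightarrow> linf_mod_c0 \<Rightarrow> linf_mod_c0" is "(-)"
  using subspace_diff[OF subspace_c0] by (fastforce simp: algebra_simps)

lift_definition uminus_linf_mod_c0 :: "linf_mod_c0 \<Rightarrow> linf_mod_c0" is uminus
  using subspace_neg[OF subspace_c0] by fastforce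

lift_definition scaleR_linf_mod_c0 :: "real \<Rightarrow> linf_mod_c0 \<Rightarrow> linf_mod_c0" is scaleR
  using subspace_scale[OF subspace_c0] by (fastforce simp flip: scaleR_diff_right)

instance
proof
  fix x y z :: linf_mod_c0 and a b :: real
  note eq0 = subspace_0[OF subspace_c0]
  show "x + y + z = x + (y + z)" by transfer (simp add: eq0 add.assoc)
  show "x + y = y + x" by transfer (simp add: eq0 add.commute)
  show "0 + x = x" by transfer (simp add: eq0)
  show "- x + x = 0" by transfer (simp add: eq0)
  show "x - y = x + - y" by transfer (simp add: eq0)
  show "a *\<^sub>R (x + y) = a *\<^sub>R x + a *\<^sub>R y" by transfer (simp add: eq0 scaleR_add_right)
  show "(a + b) *\<^sub>R x = a *\<^sub>R x + b *\<^sub>R x" by transfer (simp add: eq0 scaleR_add_left)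
  show "a *\<^sub>R b *\<^sub>R x = (a * b) *\<^sub>R x" by transfer (simp add: eq0)
  show "1 *\<^sub>R x = x" by transfer (simp add: eq0)
qed

end

instantiation linf_mod_c0 :: real_normed_vector
begin

lift_definition norm_linf_mod_c0 :: "linf_mod_c0 \<Rightarrow> real" is "\<lambda>x. INF z\<in>c0. norm (x + z)"
  using subspace_neg[OF subspace_c0] by (intro antisym INF_norm_coset_le) fastforce+

definition dist_linf_mod_c0 :: "linf_mod_c0 \<Rightarrow> linf_mod_c0 \<Rightarrow> real" where
  "dist_linf_mod_c0 x y = norm (x - y)"

definition sgn_linf_mod_c0 :: "linf_mod_c0 \<Rightarrow> linf_mod_c0" where
  "sgn_linf_mod_c0 x = x /\<^sub>R norm x"

definition uniformity_linf_mod_c0 :: "(linf_mod_c0 \<times> linf_mod_c0) filter" where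
  "uniformity_linf_mod_c0 = (INF e\<in>{0 <..}. principal {(x, y). dist x y < e})"

definition open_linf_mod_c0 :: "linf_mod_c0 set \<Rightarrow> bool" where
  "open_linf_mod_c0 S = (\<forall>x\<in>S. \<forall>\<^sub>F (x', y) in uniformity. x' = x \<longrightarrow> y \<in> S)"

lemma norm_coset: "norm (coset x) = (INF z\<in>c0. norm (x + z))"
  by (rule norm_linf_mod_c0.abs_eq)

lemma norm_coset_le_rep: "z \<in> c0 \<Longrightarrow> norm (coset x) \<le> norm (x + z)"
  unfolding norm_coset by (intro cINF_lower bdd_belowI2[where m = 0]) auto

lemma norm_coset_less:
  assumes "norm (coset x) < r"
  obtains z where "z \<in> c0" "norm (x + z) < r"
proof -
  have "c0 \<noteq> {}" using subspace_0 subspace_c0 by blast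
  then show thesis
    using assms that unfolding norm_coset
    by (subst (asm) cINF_less_iff) (auto intro: bdd_belowI2[where m = 0])
qed

lemma norm_coset_nonneg: "0 \<le> norm (coset x)"
  unfolding norm_coset using subspace_0[OF subspace_c0] by (intro cINF_greatest) auto

lemma norm_coset_scaleR_le: "norm (c *\<^sub>R coset x) \<le> \<bar>c\<bar> * norm (coset x)"
proof (cases "c = 0")
  case True
  then show ?thesis
    using norm_coset_le_rep[OF subspace_0[OF subspace_c0], of 0]
    by (simp add: scaleR_linf_mod_c0.abs_eq)
next
  case False
  show ?thesis
  proof (rule field_le_epsilon)
    fix e :: real assume "0 < e"
    then have "norm (coset x) < norm (coset x) + e / \<bar>c\<bar>" using False by simp
    then obtain z where z: "z \<in> c0" "norm (x + z) < norm (coset x) + e / \<bar>c\<bar>"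
      by (rule norm_coset_less)
    have "norm (c *\<^sub>R coset x) \<le> norm (c *\<^sub>R x + c *\<^sub>R z)"
      using z subspace_c0 by (simp add: scaleR_linf_mod_c0.abs_eq norm_coset_le_rep subspace_scale)
    also have "\<dots> = \<bar>c\<bar> * norm (x + z)"
      by (metis norm_scaleR scaleR_add_right)
    also have "\<dots> \<le> \<bar>c\<bar> * (norm (coset x) + e / \<bar>c\<bar>)"
      using z by (intro mult_left_mono) auto
    also have "\<dots> = \<bar>c\<bar> * norm (coset x) + e"
      using False by (simp add: distrib_left)
    finally show "norm (c *\<^sub>R coset x) \<le> \<bar>c\<bar> * norm (coset x) + e" .
  qed
qed

instance
proof
  fix x y :: linf_mod_c0 and a :: real
  note eq0 = subspace_0[OF subspace_c0]
  obtain u where u: "x = coset u" by (rule coset_cases)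
  obtain v where v: "y = coset v" by (rule coset_cases)
  show "norm x = 0 \<longleftrightarrow> x = 0"
  proof
    assume "norm x = 0"
    have "u \<in> closure c0"
      unfolding closure_approachable
    proof (intro allI impI)
      fix e :: real assume "0 < e"
      then have "norm (coset u) < e" using \<open>norm x = 0\<close> u by simp
      then obtain z where "z \<in> c0" "norm (u + z) < e" by (rule norm_coset_less)
      then show "\<exists>w\<in>c0. dist w u < e"
        using subspace_c0
        by (intro bexI[of _ "- z"]) (auto simp: dist_norm subspace_neg norm_minus_commute)
    qed
    then have "u \<in> c0" using closed_c0 by simp
    then show "x = 0" using u by (simp add: zero_linf_mod_c0_def linf_mod_c0.abs_eq_iff)
  next
    assume "x = 0"
    then have "norm x \<le> 0"
      using norm_coset_le_rep[OF eq0, of 0] by (simp add: zero_linf_mod_c0_def)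
    then show "norm x = 0" using norm_coset_nonneg[of u] u by simp
  qed
  show "norm (x + y) \<le> norm x + norm y"
  proof (rule field_le_epsilon)
    fix e :: real assume "0 < e"
    then have "norm (coset u) < norm (coset u) + e / 2" "norm (coset v) < norm (coset v) + e / 2"
      by auto
    then obtain z w where z: "z \<in> c0" "norm (u + z) < norm (coset u) + e / 2"
      and w: "w \<in> c0" "norm (v + w) < norm (coset v) + e / 2"
      by (meson norm_coset_less)
    have "norm (x + y) \<le> norm ((u + v) + (z + w))"
      using z w subspace_c0 u v
      by (simp add: plus_linf_mod_c0.abs_eq norm_coset_le_rep subspace_add)
    also have "\<dots> \<le> norm (u + z) + norm (v + w)"
      by (metis add.assoc add.left_commute norm_triangle_ineq)
    finally show "norm (x + y) \<le> norm x + norm y + e" unfolding u v using z w by linarith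
  qed
  show "norm (a *\<^sub>R x) = \<bar>a\<bar> * norm x"
  proof (rule antisym)
    show "norm (a *\<^sub>R x) \<le> \<bar>a\<bar> * norm x" using norm_coset_scaleR_le u by simp
    show "\<bar>a\<bar> * norm x \<le> norm (a *\<^sub>R x)"
    proof (cases "a = 0")
      case True
      then show ?thesis using norm_coset_nonneg[of "a *\<^sub>R u"] u by (simp add: scaleR_linf_mod_c0.abs_eq)
    next
      case False
      have "x = inverse a *\<^sub>R coset (a *\<^sub>R u)"
        using False u by (simp add: scaleR_linf_mod_c0.abs_eq)
      then have "norm x \<le> \<bar>inverse a\<bar> * norm (coset (a *\<^sub>R u))"
        using norm_coset_scaleR_le by metis
      then show ?thesis
        using False u by (simp add: scaleR_linf_mod_c0.abs_eq field_simps abs_inverse)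
    qed
  qed
qed (rule dist_linf_mod_c0_def sgn_linf_mod_c0_def uniformity_linf_mod_c0_def open_linf_mod_c0_def)+

end

lemma coset_eq_iff: "coset x = coset y \<longleftrightarrow> x - y \<in> c0"
  by (rule linf_mod_c0.abs_eq_iff)

lemma coset_add: "coset (x + y) = coset x + coset y"
  by (simp add: plus_linf_mod_c0.abs_eq)

lemma coset_diff: "coset (x - y) = coset x - coset y"
  by (simp add: minus_linf_mod_c0.abs_eq)

lemma coset_scaleR: "coset (c *\<^sub>R x) = c *\<^sub>R coset x"
  by (simp add: scaleR_linf_mod_c0.abs_eq)

lemma coset_0: "coset 0 = 0"
  by (simp add: zero_linf_mod_c0_def)

lemma linear_coset: "linear coset"
  by (intro linearI coset_add coset_scaleR)

lemma norm_coset_le: "norm (coset x) \<le> norm x"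
  using norm_coset_le_rep[OF subspace_0[OF subspace_c0], of x] by simp

lemma bounded_linear_coset: "bounded_linear coset"
  by (intro bounded_linear_intro[where K = 1] coset_add coset_scaleR) (simp add: norm_coset_le)

lemma coset_lift_near:
  assumes "dist (coset x) q < r"
  obtains y where "coset y = q" "dist x y < r"
proof -
  obtain v where v: "q = coset v" by (rule coset_cases)
  have "norm (coset (x - v)) < r" using assms v by (simp add: dist_norm coset_diff)
  then obtain z where z: "z \<in> c0" "norm (x - v + z) < r" by (rule norm_coset_less)
  have "coset (v - z) = q"
    using z v by (simp add: coset_eq_iff subspace_neg subspace_c0)
  moreover have "dist x (v - z) < r" using z by (simp add: dist_norm algebra_simps)
  ultimately show thesis by (rule that)
qed

instance linf_mod_c0 :: banach
proof
  fix X :: "nat \<Rightarrow> linf_mod_c0"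
  assume X: "Cauchy X"
  have "\<exists>r. \<forall>n. (\<forall>m\<ge>r n. dist (X m) (X (r n)) < (1/2)^n) \<and> r n < r (Suc n)"
  proof (rule dependent_nat_choice)
    have ex: "\<exists>N>k. \<forall>m\<ge>N. dist (X m) (X N) < (1/2)^n" for n k :: nat
    proof -
      obtain M where "\<forall>m\<ge>M. \<forall>n'\<ge>M. dist (X m) (X n') < (1/2)^n"
        using X unfolding Cauchy_def by (meson half_gt_zero zero_less_one zero_less_power)
      then show ?thesis by (intro exI[of _ "max M (Suc k)"]) auto
    qed
    show "\<exists>N. \<forall>m\<ge>N. dist (X m) (X N) < (1/2)^0" using ex by blast
    show "\<exists>N. (\<forall>m\<ge>N. dist (X m) (X N) < (1/2)^Suc n) \<and> k < N" for k n using ex by blast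
  qed
  then obtain r where r: "\<And>n m. r n \<le> m \<Longrightarrow> dist (X m) (X (r n)) < (1/2)^n"
    and mono: "strict_mono r"
    by (auto simp: strict_mono_Suc_iff)
  have "\<exists>f. \<forall>n. coset (f n) = X (r n) \<and> dist (f n) (f (Suc n)) < (1/2)^n"
  proof (rule dependent_nat_choice)
    show "\<exists>x. coset x = X (r 0)" by (metis coset_cases)
    fix x n assume "coset x = X (r n)"
    then have "dist (coset x) (X (r (Suc n))) < (1/2)^n"
      using r[of n "r (Suc n)"] mono by (simp add: dist_commute strict_mono_less_eq)
    then show "\<exists>y. coset y = X (r (Suc n)) \<and> dist x y < (1/2)^n"
      by (metis coset_lift_near)
  qed
  then obtain f where f: "\<And>n. coset (f n) = X (r n)"
    and fd: "\<And>n. dist (f n) (f (Suc n)) < (1/2)^n" by auto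
  have "summable (\<lambda>n. f (Suc n) - f n)"
  proof (rule summable_comparison_test')
    show "summable (\<lambda>n. (1/2::real)^n)" by (simp add: summable_geometric)
    show "norm (f (Suc n) - f n) \<le> (1/2)^n" for n
      using fd[of n] by (simp add: dist_norm norm_minus_commute less_imp_le)
  qed
  then have "convergent (\<lambda>n. f n - f 0)"
    by (simp add: summable_iff_convergent sum_lessThan_telescope)
  then obtain l where "(\<lambda>n. f n - f 0) \<longlonglongrightarrow> l" by (auto simp: convergent_def)
  then have "(\<lambda>n. f n - f 0 + f 0) \<longlonglongrightarrow> l + f 0" by (intro tendsto_intros)
  then have "f \<longlonglongrightarrow> l + f 0" by simp
  then have "(\<lambda>n. coset (f n)) \<longlonglongrightarrow> coset (l + f 0)"
    by (rule bounded_linear.tendsto[OF bounded_linear_coset])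
  then have lim: "(X \<circ> r) \<longlonglongrightarrow> coset (l + f 0)" by (simp add: f o_def)
  show "convergent X"
    using Cauchy_converges_subseq[OF X mono lim] by (auto simp: convergent_def)
qed

definition Y_mod_c0 :: "nat filter \<Rightarrow> linf_mod_c0 set" where
  "Y_mod_c0 U = coset ` null_along U"

lemma subspace_Y_mod_c0: "subspace (Y_mod_c0 U)"
  unfolding Y_mod_c0_def by (intro linear_subspace_image linear_coset subspace_null_along)

lemma closed_Y_mod_c0:
  assumes "ultrafilter U" "nonprincipal U"
  shows "closed (Y_mod_c0 U)"
proof -
  have c0: "c0 \<subseteq> null_along U"
    unfolding c0_def
    by (intro null_along_mono nonprincipal_ultrafilter_le_sequentially assms)
  have "q \<in> Y_mod_c0 U" if "q \<in> closure (Y_mod_c0 U)" for q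
  proof -
    obtain x where x: "q = coset x" by (rule coset_cases)
    have "x \<in> closure (null_along U)"
      unfolding closure_approachable
    proof (intro allI impI)
      fix e :: real assume "0 < e"
      then obtain y where y: "y \<in> null_along U" "dist (coset y) (coset x) < e"
        using \<open>q \<in> closure (Y_mod_c0 U)\<close> x by (auto simp: closure_approachable Y_mod_c0_def)
      then have "dist (coset x) (coset y) < e" by (simp add: dist_commute)
      then obtain w where w: "coset w = coset y" "dist x w < e" by (rule coset_lift_near)
      then have "w - y \<in> null_along U" using c0 by (auto simp: coset_eq_iff)
      then have "w \<in> null_along U"
        using subspace_add[OF subspace_null_along _ y(1), of "w - y"] by simp
      then show "\<exists>w\<in>null_along U. dist w x < e" using w by (auto simp: dist_commute)
    qed
    then have "x \<in> null_along U" using closed_null_along by (simp add: closure_closed)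
    then show ?thesis using x by (simp add: Y_mod_c0_def)
  qed
  then show ?thesis by (metis closure_subset_eq subsetI)
qed

end

theory Submission
  imports Defs
begin

text \<open>
  Why the theorem holds. Let \<open>x\<close> and \<open>y\<close> represent elements of \<open>Y/c0\<close> with \<open>limsup |x n| = 1\<close> and
  \<open>limsup |y n| \<le> 1\<close>, and let \<open>e > 0\<close>. A permutation \<open>\<sigma>\<close> of the indices that is the identity on a set
  of \<open>U\<close>, followed by a change of signs, preserves both \<open>Y\<close> and \<open>c0\<close>, and so induces an isometric
  automorphism of \<open>Y/c0\<close> (\<open>coset_signed_rearrangement_mem_orbit\<close>). These maps suffice.

  Let \<open>A\<close> be the set of indices at which \<open>|x|\<close> exceeds \<open>1 - e\<close>, and \<open>B\<close> the set of those at which \<open>|y|\<close>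
  is at least \<open>e\<close>. The set \<open>A\<close> is infinite, because \<open>x + c0\<close> has norm 1, and neither \<open>A\<close> nor \<open>B\<close> belongs
  to \<open>U\<close>, because \<open>x\<close> and \<open>y\<close> tend to 0 along \<open>U\<close>. Hence there is room, outside some set of \<open>U\<close>, for a
  permutation \<open>\<sigma>\<close> that moves \<open>B\<close> into \<open>A\<close> (\<open>ex_perm_image_subset_fixing_ultrafilter\<close>). Then
  \<open>z = |x \<circ> \<sigma>|\<close> is close to 1 on \<open>B\<close>, and is bounded by about 1 elsewhere.

  All the products \<open>\<theta> z\<close>, with \<open>\<theta>\<close> a sequence of signs, lie in the orbit of \<open>x\<close>. Averages of sign
  sequences are uniformly dense among the sequences with values in \<open>[-1, 1]\<close>
  (\<open>uniform_approx_midpoint_signs\<close>), so the convex hull of the orbit contains some \<open>w z\<close> with \<open>w\<close>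
  uniformly close to \<open>y\<close>. Finally \<open>y z\<close> is close to \<open>y\<close>: on \<open>B\<close> because \<open>z\<close> is close to 1 there, and
  off \<open>B\<close> because \<open>y\<close> itself is small (\<open>approx_in_convex_hull_orbit\<close>).
\<close>

section \<open>Signed rearrangements\<close>

text \<open>
  The weights need not be signs: weights in \<open>[-1, 1]\<close> arise as averages of signs, and weights in
  \<open>{0, 1}\<close> restrict a sequence to a set of indices. The value is meaningful for bounded weights only.
\<close>

definition weighted_rearrangement :: "(nat \<Rightarrow> real) \<Rightarrow> (nat \<Rightarrow> nat) \<Rightarrow> linf \<Rightarrow> linf" where
  "weighted_rearrangement w \<sigma> x = Bcontfun (\<lambda>n. w n * apply_bcontfun x (\<sigma> n))"

lemma apply_weighted_rearrangement:
  assumes "\<And>n. \<bar>w n\<bar> \<le> 1"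
  shows "apply_bcontfun (weighted_rearrangement w \<sigma> x) n = w n * apply_bcontfun x (\<sigma> n)"
proof -
  have "\<bar>w k\<bar> * \<bar>apply_bcontfun x (\<sigma> k)\<bar> \<le> 1 * norm x" for k
    by (intro mult_mono assms) (use norm_bounded[of x "\<sigma> k"] in auto)
  then have "(\<lambda>k. w k * apply_bcontfun x (\<sigma> k)) \<in> bcontfun"
    unfolding mem_linf_iff by (intro boundedI) (auto simp: abs_mult)
  then show ?thesis
    unfolding weighted_rearrangement_def by (simp add: Bcontfun_inverse)
qed

lemma linear_weighted_rearrangement:
  assumes "\<And>n. \<bar>w n\<bar> \<le> 1"
  shows "linear (weighted_rearrangement w \<sigma>)"
  by (intro linearI bcontfun_eqI) (simp_all add: apply_weighted_rearrangement assms algebra_simps)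

lemma norm_weighted_rearrangement_le:
  assumes "\<And>n. \<bar>w n\<bar> \<le> 1"
  shows "norm (weighted_rearrangement w \<sigma> x) \<le> norm x"
proof (rule norm_bound)
  fix n
  have "\<bar>w n\<bar> * \<bar>apply_bcontfun x (\<sigma> n)\<bar> \<le> 1 * norm x"
    by (intro mult_mono assms) (use norm_bounded[of x "\<sigma> n"] in auto)
  then show "norm (apply_bcontfun (weighted_rearrangement w \<sigma> x) n) \<le> norm x"
    by (simp add: apply_weighted_rearrangement assms abs_mult)
qed

lemma weighted_rearrangement_null_along:
  assumes w: "\<And>n. \<bar>w n\<bar> \<le> 1" and \<sigma>: "filterlim \<sigma> F F" and x: "x \<in> null_along F"
  shows "weighted_rearrangement w \<sigma> x \<in> null_along F"
proof -
  have "((\<lambda>n. apply_bcontfun x (\<sigma> n)) \<longlongrightarrow> 0) F"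
    using x filterlim_compose[OF _ \<sigma>] by (auto simp: null_along_def)
  then have "((\<lambda>n. w n * apply_bcontfun x (\<sigma> n)) \<longlongrightarrow> 0) F"
    by (rule Lim_null_comparison[rotated, OF tendsto_rabs_zero])
      (auto intro!: always_eventually mult_left_le_one_le simp: abs_mult w)
  moreover have "apply_bcontfun (weighted_rearrangement w \<sigma> x) = (\<lambda>n. w n * apply_bcontfun x (\<sigma> n))"
    using w by (intro ext apply_weighted_rearrangement)
  ultimately show ?thesis
    by (simp add: null_along_def)
qed

lemma filterlim_inj_sequentially:
  fixes \<sigma> :: "nat \<Rightarrow> nat"
  assumes "inj \<sigma>"
  shows "filterlim \<sigma> sequentially sequentially"
  unfolding cofinite_eq_sequentially[symmetric] filterlim_iff
  using MOST_inj[OF _ assms] by blast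

lemma filterlim_eventually_id:
  assumes "\<forall>\<^sub>F n in F. \<sigma> n = n"
  shows "filterlim \<sigma> F F"
  unfolding filterlim_iff
proof (intro allI impI)
  fix P assume "eventually P F"
  with assms show "\<forall>\<^sub>F n in F. P (\<sigma> n)"
    by eventually_elim simp
qed

lemma signed_rearrangement_inverse:
  assumes \<theta>: "\<And>n. \<bar>\<theta> n\<bar> = 1" and \<sigma>: "bij \<sigma>"
  shows "weighted_rearrangement \<theta> \<sigma> (weighted_rearrangement (\<theta> \<circ> inv \<sigma>) (inv \<sigma>) x) = x"
    and "weighted_rearrangement (\<theta> \<circ> inv \<sigma>) (inv \<sigma>) (weighted_rearrangement \<theta> \<sigma> x) = x"
proof -
  have "\<theta> n * (\<theta> n * r) = r" for n r
    using \<theta>[of n] by (cases "\<theta> n \<ge> 0") auto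
  then show "weighted_rearrangement \<theta> \<sigma> (weighted_rearrangement (\<theta> \<circ> inv \<sigma>) (inv \<sigma>) x) = x"
    and "weighted_rearrangement (\<theta> \<circ> inv \<sigma>) (inv \<sigma>) (weighted_rearrangement \<theta> \<sigma> x) = x"
    using \<sigma> by (auto intro!: bcontfun_eqI
      simp: apply_weighted_rearrangement \<theta> bij_is_inj bij_is_surj surj_f_inv_f inv_f_f)
qed

lemma norm_signed_rearrangement:
  assumes \<theta>: "\<And>n. \<bar>\<theta> n\<bar> = 1" and \<sigma>: "bij \<sigma>"
  shows "norm (weighted_rearrangement \<theta> \<sigma> x) = norm x"
proof (rule antisym)
  show "norm (weighted_rearrangement \<theta> \<sigma> x) \<le> norm x"
    by (rule norm_weighted_rearrangement_le) (simp add: \<theta>)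
  show "norm x \<le> norm (weighted_rearrangement \<theta> \<sigma> x)"
    using norm_weighted_rearrangement_le[of "\<theta> \<circ> inv \<sigma>" "inv \<sigma>" "weighted_rearrangement \<theta> \<sigma> x"]
    by (simp add: \<theta> signed_rearrangement_inverse[OF \<theta> \<sigma>])
qed

lemma signed_rearrangement_image_null_along:
  assumes \<theta>: "\<And>n. \<bar>\<theta> n\<bar> = 1" and \<sigma>: "bij \<sigma>"
    and "filterlim \<sigma> F F" "filterlim (inv \<sigma>) F F"
  shows "weighted_rearrangement \<theta> \<sigma> ` null_along F = null_along F"
proof (intro equalityI subsetI)
  fix x assume "x \<in> null_along F"
  then have "weighted_rearrangement (\<theta> \<circ> inv \<sigma>) (inv \<sigma>) x \<in> null_along F"
    by (intro weighted_rearrangement_null_along assms) (simp add: \<theta>)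
  then show "x \<in> weighted_rearrangement \<theta> \<sigma> ` null_along F"
    by (rule image_eqI[rotated]) (simp add: signed_rearrangement_inverse[OF \<theta> \<sigma>])
qed (auto intro!: weighted_rearrangement_null_along assms simp: \<theta>)

text \<open>
  The norm of a coset is a distance to \<open>c0\<close>, so an isometry of \<open>linf\<close> that maps \<open>c0\<close> onto itself
  induces a norm-preserving map on cosets. Surjectivity on the cosets of \<open>Y\<close> is read off from the
  image of \<open>Y\<close>.
\<close>

lemma isometric_automorphism_of_lift:
  assumes L: "linear L" and norm_L: "\<And>x. norm (L x) = norm x"
    and c0: "L ` c0 = c0" and Y: "L ` null_along U = null_along U"
  obtains T where "T \<in> isometric_automorphisms (Y_mod_c0 U)" "\<And>x. T (coset x) = coset (L x)"
proof -
  have "\<exists>t. \<forall>x. q = coset x \<longrightarrow> t = coset (L x)" for q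
  proof -
    obtain u where u: "q = coset u" by (rule coset_cases)
    have "coset (L u) = coset (L x)" if "q = coset x" for x
    proof -
      have "u - x \<in> c0" using that u by (simp add: coset_eq_iff)
      then have "L (u - x) \<in> c0" using c0 by blast
      then show ?thesis by (simp add: coset_eq_iff linear_diff[OF L])
    qed
    then show ?thesis by blast
  qed
  then obtain T where T: "\<And>x. T (coset x) = coset (L x)" by metis
  have "norm (coset (L x)) = norm (coset x)" for x
  proof -
    have "norm (coset (L x)) = (INF z\<in>L ` c0. norm (L x + z))"
      by (simp add: norm_coset c0)
    also have "\<dots> = (INF z\<in>c0. norm (L x + L z))"
      by (simp add: image_image)
    also have "\<dots> = (INF z\<in>c0. norm (x + z))"
      by (simp add: norm_L flip: linear_add[OF L])
    finally show ?thesis by (simp add: norm_coset)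
  qed
  moreover have "T ` coset ` null_along U = coset ` L ` null_along U"
    by (simp add: image_image T)
  ultimately have "T \<in> isometric_automorphisms (Y_mod_c0 U)"
    unfolding isometric_automorphisms_def Y_mod_c0_def
    by (auto simp: T Y linear_add[OF L] linear_scale[OF L] simp flip: coset_add coset_scaleR)
  then show thesis using T that by blast
qed

text \<open>
  Every permutation of the indices preserves convergence to 0 at infinity, hence \<open>c0\<close>; the
  hypothesis that it is the identity on a set of \<open>U\<close> makes it preserve limits along \<open>U\<close>, hence \<open>Y\<close>.
\<close>

lemma coset_signed_rearrangement_mem_orbit:
  assumes \<theta>: "\<And>n. \<bar>\<theta> n\<bar> = 1" and \<sigma>: "bij \<sigma>" and id: "\<forall>\<^sub>F n in U. \<sigma> n = n"
  shows "coset (weighted_rearrangement \<theta> \<sigma> x) \<in> isometric_orbit (Y_mod_c0 U) (coset x)"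
proof -
  have inv_id: "\<forall>\<^sub>F n in U. inv \<sigma> n = n"
    using id by eventually_elim (metis \<sigma> bij_is_inj inv_f_f)
  have w: "\<bar>\<theta> n\<bar> \<le> 1" for n by (simp add: \<theta>)
  obtain T where T: "T \<in> isometric_automorphisms (Y_mod_c0 U)"
    "\<And>x. T (coset x) = coset (weighted_rearrangement \<theta> \<sigma> x)"
  proof (rule isometric_automorphism_of_lift)
    show "linear (weighted_rearrangement \<theta> \<sigma>)"
      by (rule linear_weighted_rearrangement[OF w])
    show "norm (weighted_rearrangement \<theta> \<sigma> x) = norm x" for x
      by (rule norm_signed_rearrangement[OF \<theta> \<sigma>])
    show "weighted_rearrangement \<theta> \<sigma> ` c0 = c0"
      unfolding c0_def using \<sigma>
      by (intro signed_rearrangement_image_null_along[OF \<theta>] filterlim_inj_sequentially)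
        (auto simp: bij_is_inj bij_imp_bij_inv)
    show "weighted_rearrangement \<theta> \<sigma> ` null_along U = null_along U"
      by (intro signed_rearrangement_image_null_along[OF \<theta> \<sigma>] filterlim_eventually_id id inv_id)
  qed blast
  show ?thesis unfolding isometric_orbit_def using T by (auto simp flip: T(2))
qed


section \<open>Permutations fixing the ultrafilter\<close>

text \<open>
  A bijection of \<open>A \<union> B\<close> onto \<open>A\<close> moves \<open>B\<close> into \<open>A\<close> as required, but to extend it to a permutation one
  has to cover \<open>B - A\<close> as well. An infinite set \<open>C\<close> disjoint from \<open>A \<union> B\<close> absorbs the deficit: it is
  mapped onto \<open>C \<union> (B - A)\<close>. Such a \<open>C\<close> exists outside \<open>U\<close>, because of two disjoint infinite subsets of
  the complement of \<open>A \<union> B\<close> at most one belongs to \<open>U\<close>.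
\<close>

lemma ex_perm_image_subset_fixing_ultrafilter:
  fixes A B :: "nat set"
  assumes uf: "ultrafilter U" and np: "nonprincipal U"
    and A: "\<forall>\<^sub>F n in U. n \<notin> A" "infinite A" and B: "\<forall>\<^sub>F n in U. n \<notin> B"
  obtains \<sigma> where "bij \<sigma>" "\<sigma> ` B \<subseteq> A" "\<forall>\<^sub>F n in U. \<sigma> n = n"
proof -
  have U: "\<forall>\<^sub>F n in U. n \<notin> A \<union> B"
    using A(1) B by eventually_elim auto
  have "infinite (- (A \<union> B))"
  proof
    assume "finite (- (A \<union> B))"
    then have "\<forall>\<^sub>F n in sequentially. n \<in> A \<union> B"
      by (simp add: cofinite_eq_sequentially[symmetric] eventually_cofinite Compl_eq)
    then have "\<forall>\<^sub>F n in U. n \<in> A \<union> B"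
      by (rule filter_leD[OF nonprincipal_ultrafilter_le_sequentially[OF uf np]])
    with U have "\<forall>\<^sub>F n in U. False" by eventually_elim simp
    then show False using uf by (simp add: ultrafilter_def trivial_limit_def)
  qed
  then obtain C1 C2 where C12: "C1 \<subseteq> - (A \<union> B)" "C2 \<subseteq> - (A \<union> B)" "infinite C1" "infinite C2" "C1 \<inter> C2 = {}"
    by (metis infinite_split)
  have "(\<forall>\<^sub>F n in U. n \<notin> C1) \<or> (\<forall>\<^sub>F n in U. n \<notin> C2)"
  proof (rule disjCI)
    assume "\<not> (\<forall>\<^sub>F n in U. n \<notin> C2)"
    then have "\<forall>\<^sub>F n in U. n \<in> C2" using uf by (auto simp: ultrafilter_def)
    then show "\<forall>\<^sub>F n in U. n \<notin> C1" by eventually_elim (use C12(5) in auto)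
  qed
  with C12 obtain C where C: "C \<subseteq> - (A \<union> B)" "infinite C" "\<forall>\<^sub>F n in U. n \<notin> C" by blast
  have bij: "\<exists>f. bij_betw f P Q" if "infinite P" "infinite Q" for P Q :: "nat set"
    by (metis that bij_enumerate bij_betw_inv bij_betw_trans)
  obtain f where f: "bij_betw f (A \<union> B) A" using bij A(2) by (meson finite_Un)
  obtain g where g: "bij_betw g C (C \<union> (B - A))" using bij C(2) by (meson finite_Un)
  define \<sigma> where "\<sigma> n = (if n \<in> A \<union> B then f n else if n \<in> C then g n else n)" for n
  have "bij_betw \<sigma> ((A \<union> B) \<union> (C \<union> - (A \<union> B \<union> C))) (A \<union> ((C \<union> (B - A)) \<union> - (A \<union> B \<union> C)))"
  proof (intro bij_betw_combine)
    show "bij_betw \<sigma> (A \<union> B) A"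
      by (rule bij_betw_cong[THEN iffD1, OF _ f]) (simp add: \<sigma>_def)
    show "bij_betw \<sigma> C (C \<union> (B - A))"
      by (rule bij_betw_cong[THEN iffD1, OF _ g]) (use C(1) in \<open>auto simp: \<sigma>_def\<close>)
    show "bij_betw \<sigma> (- (A \<union> B \<union> C)) (- (A \<union> B \<union> C))"
      by (rule bij_betw_cong[THEN iffD1, OF _ bij_betw_id]) (auto simp: \<sigma>_def)
  qed (use C(1) in auto)
  moreover have "(A \<union> B) \<union> (C \<union> - (A \<union> B \<union> C)) = UNIV"
    "A \<union> ((C \<union> (B - A)) \<union> - (A \<union> B \<union> C)) = UNIV" by auto
  ultimately have "bij \<sigma>" by simp
  moreover have "\<sigma> ` B \<subseteq> A"
    using bij_betw_imp_surj_on[OF f] by (auto simp: \<sigma>_def)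
  moreover have "\<forall>\<^sub>F n in U. \<sigma> n = n"
    using U C(3) by eventually_elim (simp add: \<sigma>_def)
  ultimately show thesis by (rule that)
qed


section \<open>Approximation by sign sequences\<close>

text \<open>
  This is binary expansion with digits \<open>1\<close> and \<open>-1\<close>: if \<open>s\<close> is the sign of \<open>y\<close> and \<open>|y| \<le> 1\<close>, then
  \<open>|2 y - s| \<le> 1\<close> and \<open>y\<close> is the midpoint of \<open>s\<close> and \<open>2 y - s\<close>, so an approximation of \<open>2 y - s\<close>
  yields one of \<open>y\<close> with half the error.
\<close>

lemma uniform_approx_midpoint_signs:
  fixes W :: "('a \<Rightarrow> real) set"
  assumes signs: "\<And>\<theta>. (\<And>a. \<bar>\<theta> a\<bar> = 1) \<Longrightarrow> \<theta> \<in> W"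
    and midpoint: "\<And>v w. v \<in> W \<Longrightarrow> w \<in> W \<Longrightarrow> (\<lambda>a. (v a + w a) / 2) \<in> W"
    and y: "\<And>a. \<bar>y a\<bar> \<le> 1" and e: "0 < e"
  obtains w where "w \<in> W" "\<And>a. \<bar>w a - y a\<bar> < e"
proof -
  define sg :: "real \<Rightarrow> real" where "sg r = (if r \<ge> 0 then 1 else - 1)" for r
  have "\<exists>w\<in>W. \<forall>a. \<bar>w a - y a\<bar> \<le> (1/2) ^ m" if "\<forall>a. \<bar>y a\<bar> \<le> 1" for m y
    using that
  proof (induction m arbitrary: y)
    case 0
    have "(\<lambda>a. sg (y a)) \<in> W" by (rule signs) (simp add: sg_def)
    moreover have "\<bar>sg (y a) - y a\<bar> \<le> (1/2) ^ 0" for a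
      using 0[rule_format, of a] by (auto simp: sg_def abs_if split: if_splits)
    ultimately show ?case by (intro bexI[of _ "\<lambda>a. sg (y a)"] allI)
  next
    case (Suc m)
    have "\<bar>2 * y a - sg (y a)\<bar> \<le> 1" for a
      using Suc.prems[rule_format, of a] by (auto simp: sg_def abs_if split: if_splits)
    then obtain w where w: "w \<in> W" "\<And>a. \<bar>w a - (2 * y a - sg (y a))\<bar> \<le> (1/2) ^ m"
      using Suc.IH[of "\<lambda>a. 2 * y a - sg (y a)"] by blast
    have "(\<lambda>a. (sg (y a) + w a) / 2) \<in> W"
      by (intro midpoint signs w) (simp add: sg_def)
    moreover have "\<bar>(sg (y a) + w a) / 2 - y a\<bar> \<le> (1/2) ^ Suc m" for a
    proof -
      have "(sg (y a) + w a) / 2 - y a = (w a - (2 * y a - sg (y a))) / 2"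
        by (simp add: field_simps)
      then have "\<bar>(sg (y a) + w a) / 2 - y a\<bar> = \<bar>w a - (2 * y a - sg (y a))\<bar> / 2"
        by (simp only: abs_divide abs_numeral)
      also have "\<dots> \<le> (1/2) ^ m / 2"
        by (rule divide_right_mono[OF w(2)]) simp
      also have "\<dots> = (1/2) ^ Suc m" by simp
      finally show ?thesis .
    qed
    ultimately show ?case by (intro bexI[of _ "\<lambda>a. (sg (y a) + w a) / 2"] allI)
  qed
  moreover obtain m where "(1/2) ^ m < e"
    using real_arch_pow_inv[OF e, of "1/2"] by auto
  ultimately show thesis using y that by (meson order.strict_trans1)
qed


section \<open>Convex transitivity\<close>

text \<open>
  If \<open>|x n|\<close> exceeded \<open>r\<close> only finitely often, then deleting these entries, which is a change by an
  element of \<open>c0\<close>, would produce a representative of norm at most \<open>r\<close>.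
\<close>

lemma infinite_near_norm:
  assumes "0 \<le> r" "r < norm (coset x)"
  shows "infinite {n. r < \<bar>apply_bcontfun x n\<bar>}"
proof
  assume fin: "finite {n. r < \<bar>apply_bcontfun x n\<bar>}"
  define u where "u n = (if r < \<bar>apply_bcontfun x n\<bar> then 1 else 0 :: real)" for n
  have u: "\<bar>u n\<bar> \<le> 1" for n by (simp add: u_def)
  define z where "z = weighted_rearrangement u id x"
  have z: "apply_bcontfun z n = u n * apply_bcontfun x n" for n
    by (simp add: z_def apply_weighted_rearrangement u)
  have "\<forall>\<^sub>F n in sequentially. apply_bcontfun z n = 0"
    unfolding cofinite_eq_sequentially[symmetric] eventually_cofinite
    by (rule finite_subset[OF _ fin]) (auto simp: z u_def)
  then have "z \<in> c0"
    unfolding c0_def null_along_def by (simp add: tendsto_eventually)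
  then have "coset x = coset (x - z)"
    by (simp add: coset_eq_iff)
  also have "norm (coset (x - z)) \<le> norm (x - z)" by (rule norm_coset_le)
  also have "norm (x - z) \<le> r"
    using assms(1) by (intro norm_bound) (auto simp: z u_def)
  finally show False using assms by simp
qed

lemma approx_in_convex_hull_orbit:
  assumes uf: "ultrafilter U" and np: "nonprincipal U"
    and x: "x \<in> null_along U" "norm x \<le> 1 + e" "1 - e < norm (coset x)"
    and y: "y \<in> null_along U" "norm y \<le> 1" and e: "0 < e" "e < 1"
  obtains h where "h \<in> convex hull (isometric_orbit (Y_mod_c0 U) (coset x))"
    "norm (h - coset y) \<le> 3 * e"
proof -
  define H where "H = convex hull (isometric_orbit (Y_mod_c0 U) (coset x))"
  define A where "A = {n. 1 - e < \<bar>apply_bcontfun x n\<bar>}"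
  define B where "B = {n. e \<le> \<bar>apply_bcontfun y n\<bar>}"
  have "\<forall>\<^sub>F n in U. dist (apply_bcontfun x n) 0 < 1 - e"
    using x(1) e by (intro tendstoD) (auto simp: null_along_def)
  then have A: "\<forall>\<^sub>F n in U. n \<notin> A" by eventually_elim (simp add: A_def)
  have "\<forall>\<^sub>F n in U. dist (apply_bcontfun y n) 0 < e"
    using y(1) e by (intro tendstoD) (auto simp: null_along_def)
  then have B: "\<forall>\<^sub>F n in U. n \<notin> B" by eventually_elim (simp add: B_def)
  have "infinite A" unfolding A_def using e by (intro infinite_near_norm x(3)) simp
  then obtain \<sigma> where \<sigma>: "bij \<sigma>" "\<sigma> ` B \<subseteq> A" "\<forall>\<^sub>F n in U. \<sigma> n = n"
    using ex_perm_image_subset_fixing_ultrafilter[OF uf np A _ B] by blast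

  \<comment> \<open>\<open>R w\<close> is the product of \<open>w\<close> and \<open>|x \<circ> \<sigma>|\<close>; it is linear in \<open>w\<close>, and lies over the orbit when \<open>w\<close>
    consists of signs. Hence \<open>W\<close> contains all sign sequences and is closed under midpoints.\<close>
  define s where "s n = (if apply_bcontfun x (\<sigma> n) < 0 then - 1 else 1 :: real)" for n
  define R where "R w = weighted_rearrangement (\<lambda>n. w n * s n) \<sigma> x" for w
  define W where "W = {w. (\<forall>n. \<bar>w n\<bar> \<le> 1) \<and> coset (R w) \<in> H}"
  have R: "apply_bcontfun (R w) n = w n * \<bar>apply_bcontfun x (\<sigma> n)\<bar>" if "\<forall>n. \<bar>w n\<bar> \<le> 1" for w n
    unfolding R_def using that by (subst apply_weighted_rearrangement) (auto simp: s_def abs_mult)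

  obtain w where w: "w \<in> W" and wy: "\<And>n. \<bar>w n - apply_bcontfun y n\<bar> < e"
  proof (rule uniform_approx_midpoint_signs[of W "apply_bcontfun y" e])
    fix \<theta> :: "nat \<Rightarrow> real" assume \<theta>: "\<And>n. \<bar>\<theta> n\<bar> = 1"
    have "coset (R \<theta>) \<in> isometric_orbit (Y_mod_c0 U) (coset x)"
      unfolding R_def by (intro coset_signed_rearrangement_mem_orbit \<sigma>) (simp add: abs_mult \<theta> s_def)
    then show "\<theta> \<in> W" unfolding W_def H_def by (auto simp: \<theta> hull_inc)
  next
    fix v w assume vw: "v \<in> W" "w \<in> W"
    have m: "\<bar>(v n + w n) / 2\<bar> \<le> 1" for n
    proof -
      have "\<bar>v n + w n\<bar> \<le> 1 + 1"
        using vw by (intro order_trans[OF abs_triangle_ineq add_mono]) (auto simp: W_def)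
      then show ?thesis by simp
    qed
    have "R (\<lambda>n. (v n + w n) / 2) = (1/2) *\<^sub>R R v + (1/2) *\<^sub>R R w"
      using vw m by (intro bcontfun_eqI) (simp add: R W_def field_simps)
    moreover have "(1/2) *\<^sub>R coset (R v) + (1/2) *\<^sub>R coset (R w) \<in> H"
      using vw unfolding W_def H_def by (intro convexD convex_convex_hull) auto
    ultimately show "(\<lambda>n. (v n + w n) / 2) \<in> W"
      using m by (simp add: W_def coset_add coset_scaleR)
  next
    show "\<bar>apply_bcontfun y n\<bar> \<le> 1" for n
      using norm_bounded[of y n] y(2) by simp
  qed (use e in blast)+

  have "norm (R w - y) \<le> 3 * e"
  proof (rule norm_bound)
    fix n
    define z where "z = \<bar>apply_bcontfun x (\<sigma> n)\<bar>"
    have z: "0 \<le> z" "z \<le> 1 + e" using norm_bounded[of x "\<sigma> n"] x(2) by (auto simp: z_def)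
    have yn: "\<bar>apply_bcontfun y n\<bar> \<le> 1" using norm_bounded[of y n] y(2) by simp
    have Rn: "apply_bcontfun (R w - y) n = w n * z - apply_bcontfun y n"
      using w by (simp add: R W_def z_def)
    have wz: "\<bar>w n - apply_bcontfun y n\<bar> * z \<le> e * 2"
      using wy[of n] z e by (intro mult_mono) auto
    have split: "w n * z - apply_bcontfun y n
        = (w n - apply_bcontfun y n) * z + apply_bcontfun y n * (z - 1)"
      by (simp add: algebra_simps)
    have "\<bar>apply_bcontfun y n\<bar> * \<bar>z - 1\<bar> \<le> e"
    proof (cases "n \<in> B")
      case True
      then have "1 - e < z" using \<sigma>(2) by (auto simp: A_def z_def)
      then have "\<bar>apply_bcontfun y n\<bar> * \<bar>z - 1\<bar> \<le> 1 * e"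
        using yn z by (intro mult_mono) auto
      then show ?thesis by simp
    next
      case False
      then have "\<bar>apply_bcontfun y n\<bar> * \<bar>z - 1\<bar> \<le> e * 1"
        using z e by (intro mult_mono) (auto simp: B_def)
      then show ?thesis by simp
    qed
    then have "\<bar>w n * z - apply_bcontfun y n\<bar> \<le> e * 2 + e"
      unfolding split using wz
      by (intro order_trans[OF abs_triangle_ineq] add_mono) (use z in \<open>auto simp: abs_mult\<close>)
    then show "norm (apply_bcontfun (R w - y) n) \<le> 3 * e"
      unfolding Rn using e by simp
  qed
  then have "norm (coset (R w) - coset y) \<le> 3 * e"
    using norm_coset_le[of "R w - y"] by (simp add: coset_diff)
  moreover have "coset (R w) \<in> H" using w by (simp add: W_def)
  ultimately show thesis using that unfolding H_def by blast
qed

lemma coset_Y_small_rep: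
  assumes np: "ultrafilter U" "nonprincipal U" and q: "q \<in> Y_mod_c0 U" "norm q < r"
  obtains x where "x \<in> null_along U" "q = coset x" "norm x < r"
proof -
  obtain u where u: "u \<in> null_along U" "q = coset u" using q(1) by (auto simp: Y_mod_c0_def)
  obtain z where z: "z \<in> c0" "norm (u + z) < r" using q(2) u(2) norm_coset_less by blast
  have "z \<in> null_along U"
    using z(1) null_along_mono[OF nonprincipal_ultrafilter_le_sequentially[OF np]]
    by (auto simp: c0_def)
  then have "u + z \<in> null_along U" using u(1) by (intro subspace_add subspace_null_along)
  moreover have "q = coset (u + z)"
    using u(2) z(1) by (simp add: coset_eq_iff subspace_neg subspace_c0)
  ultimately show thesis using z(2) that by blast
qed

theorem theorem3p4:
  fixes U :: "nat filter"
  assumes "ultrafilter U" and "nonprincipal U"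
  shows "convex_transitive (Y_mod_c0 U)"
  unfolding convex_transitive_def
proof (intro ballI impI equalityI)
  fix p assume p: "p \<in> Y_mod_c0 U" "norm p = 1"
  have ball: "{q \<in> Y_mod_c0 U. norm q \<le> 1} = Y_mod_c0 U \<inter> cball 0 1" by auto
  have "isometric_orbit (Y_mod_c0 U) p \<subseteq> Y_mod_c0 U \<inter> cball 0 1"
    using p by (auto simp: isometric_orbit_def isometric_automorphisms_def)
  then show "closure (convex hull (isometric_orbit (Y_mod_c0 U) p)) \<subseteq> {q \<in> Y_mod_c0 U. norm q \<le> 1}"
    unfolding ball
    by (intro closure_minimal hull_minimal closed_Int closed_Y_mod_c0 assms convex_Int
        subspace_imp_convex[OF subspace_Y_mod_c0] convex_cball closed_cball)
  show "{q \<in> Y_mod_c0 U. norm q \<le> 1} \<subseteq> closure (convex hull (isometric_orbit (Y_mod_c0 U) p))"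
  proof
    fix q assume "q \<in> {q \<in> Y_mod_c0 U. norm q \<le> 1}"
    then have q: "q \<in> Y_mod_c0 U" "norm q \<le> 1" by auto
    show "q \<in> closure (convex hull (isometric_orbit (Y_mod_c0 U) p))"
      unfolding closure_approachable
    proof (intro allI impI)
      fix d :: real assume d: "0 < d"
      define e where "e = min (1/2) (d / 5)"
      have e: "0 < e" "e < 1" "5 * e \<le> d" using d by (auto simp: e_def)
      \<comment> \<open>The norm of a coset is an infimum over its representatives. Shrinking \<open>q\<close> by the factor
        \<open>1 - e\<close>, at a cost of at most \<open>e\<close>, provides a representative in the unit ball.\<close>
      obtain x where x: "x \<in> null_along U" "p = coset x" "norm x < 1 + e"
        using coset_Y_small_rep[OF assms p(1), of "1 + e"] p(2) e by auto
      have "norm ((1 - e) *\<^sub>R q) \<le> (1 - e) * 1"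
        using q e by (simp add: mult_left_le)
      also have "\<dots> < 1" using e by simp
      finally obtain y where y: "y \<in> null_along U" "(1 - e) *\<^sub>R q = coset y" "norm y < 1"
        using coset_Y_small_rep[OF assms, of "(1 - e) *\<^sub>R q" 1] q(1) e
        by (auto simp: subspace_scale subspace_Y_mod_c0)
      obtain h where h: "h \<in> convex hull (isometric_orbit (Y_mod_c0 U) p)"
        "norm (h - coset y) \<le> 3 * e"
        using approx_in_convex_hull_orbit[OF assms x(1) _ _ y(1) _ e(1,2)] x y p e by auto
      have "q - coset y = e *\<^sub>R q" by (simp flip: y(2) add: algebra_simps)
      then have "norm (q - coset y) \<le> e * 1"
        using q(2) e by (simp add: mult_left_le)
      moreover have "norm (h - q) \<le> norm (h - coset y) + norm (q - coset y)"
        by (metis dist_norm dist_triangle2)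
      ultimately have "dist h q < d" using h(2) e by (simp add: dist_norm)
      with h(1) show "\<exists>h\<in>convex hull (isometric_orbit (Y_mod_c0 U) p). dist h q < d" by blast
    qed
  qed
qed

end
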